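(* Let $(X,\sigma,\tau)$ be a $2$-permutational solution. Then the following conditions are equivalent: (i) $(X,\sigma,\tau)$ is $2$-reductive; (ii) $(X,\sigma,\tau)$ is distributive; (iii) $\{\sigma_x,\tau_x\mid x\in X\}\subseteq\mathrm{Aut}((X,\sigma,\tau))$; (iv) the set $\{\sigma_x,\tau_x\mid x\in X\}\cup\{U,T\}$ generates an abelian permutation group; (v) the pairs $(\sigma_x,\tau_x^{-1})$, for $x\in X$, and $(U^{-1},T)$ generate an abelian group; (vi) for all $x\in X$, $U\sigma_x=\sigma_xU$ and $T\tau_x=\tau_xT$.
   Context: A solution $(X,\sigma,\tau)$ means a non-degenerate set-theoretic solution of the Yang–Baxter equation: a set $X$ (of arbitrary cardinality) with maps $\sigma,\tau:X^2\to X$, written $\sigma_x(y)=\sigma(x,y)$ and $\tau_y(x)=\tau(x,y)$, such that all $\sigma_x,\tau_y$ are bijections of $X$ and $r(x,y)=(\sigma_x(y),\tau_y(x))$ satisfies the braid relation $(\mathrm{id}\times r)(r\times \mathrm{id})(\mathrm{id}\times r)=(r\times \mathrm{id})(\mathrm{id}\times r)(r\times \mathrm{id})$ on $X^3$. Composition of maps is $(fg)(x)=f(g(x))$. The solution is $2$-permutational if $\sigma_{\sigma_x(z)}=\sigma_{\sigma_y(z)}$, $\tau_{\tau_x(z)}=\tau_{\tau_y(z)}$, $\sigma_{\tau_x(z)}=\sigma_{\tau_y(z)}$, $\tau_{\sigma_x(z)}=\tau_{\sigma_y(z)}$ for all $x,y,z\in X$. It is $2$-reductive if $\sigma_{\sigma_x(y)}=\sigma_y$,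 $\tau_{\tau_x(y)}=\tau_y$, $\sigma_{\tau_x(y)}=\sigma_y$, $\tau_{\sigma_x(y)}=\tau_y$ for all $x,y\in X$. It is distributive if $\sigma_x\sigma_y=\sigma_{\sigma_x(y)}\sigma_x$ and $\tau_x\tau_y=\tau_{\tau_x(y)}\tau_x$ for all $x,y\in X$. An automorphism of $(X,\sigma,\tau)$ is a bijection $\Phi:X\to X$ with $\Phi\sigma_x=\sigma_{\Phi(x)}\Phi$ and $\Phi\tau_x=\tau_{\Phi(x)}\Phi$ for all $x\in X$; $\mathrm{Aut}((X,\sigma,\tau))$ is the group of automorphisms. The diagonal maps are $U,T:X\to X$, $U(x)=\sigma_x^{-1}(x)$ and $T(x)=\tau_x^{-1}(x)$; they are bijections. In (v), the pairs are elements of $S(X)\times S(X)$, where $S(X)$ is the symmetric group on $X$. *)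

theory Defs
  imports "HOL-Algebra.Bij" "HOL-Algebra.Generated_Groups"
begin

text \<open>
  A solution lives on an arbitrary, possibly empty or infinite, carrier set \<open>X\<close>. The two operations
  are curried with the subscript first: \<open>\<sigma> x y\<close> is $\sigma_x(y) = \sigma(x,y)$, whereas
  \<open>\<tau> y x\<close> is $\tau_y(x) = \tau(x,y)$. Their values outside \<open>X\<close> are irrelevant; equality of two maps
  of \<open>X\<close> is equality at all points of \<open>X\<close>.
\<close>

definition ybe_map :: "('a \<Rightarrow> 'a \<Rightarrow> 'a) \<Rightarrow> ('a \<Rightarrow> 'a \<Rightarrow> 'a) \<Rightarrow> 'a \<times> 'a \<Rightarrow> 'a \<times> 'a" where
  "ybe_map \<sigma> \<tau> = (\<lambda>(x, y). (\<sigma> x y, \<tau> y x))"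

definition map_first_two :: "('a \<times> 'a \<Rightarrow> 'a \<times> 'a) \<Rightarrow> 'a \<times> 'a \<times> 'a \<Rightarrow> 'a \<times> 'a \<times> 'a" where
  "map_first_two r = (\<lambda>(x, y, z). let (u, v) = r (x, y) in (u, v, z))"

definition map_last_two :: "('a \<times> 'a \<Rightarrow> 'a \<times> 'a) \<Rightarrow> 'a \<times> 'a \<times> 'a \<Rightarrow> 'a \<times> 'a \<times> 'a" where
  "map_last_two r = map_prod id r"

definition braid_relation_on :: "'a set \<Rightarrow> ('a \<times> 'a \<Rightarrow> 'a \<times> 'a) \<Rightarrow> bool" where
  "braid_relation_on X r \<longleftrightarrow> (\<forall>t \<in> X \<times> X \<times> X.
     map_last_two r (map_first_two r (map_last_two r t)) =
     map_first_two r (map_last_two r (map_first_two r t)))"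

text \<open>Bijectivity of \<open>ybe_map \<sigma> \<tau>\<close> is not part of the definition.\<close>

definition ybe_solution :: "'a set \<Rightarrow> ('a \<Rightarrow> 'a \<Rightarrow> 'a) \<Rightarrow> ('a \<Rightarrow> 'a \<Rightarrow> 'a) \<Rightarrow> bool" where
  "ybe_solution X \<sigma> \<tau> \<longleftrightarrow>
     (\<forall>x \<in> X. bij_betw (\<sigma> x) X X) \<and> (\<forall>y \<in> X. bij_betw (\<tau> y) X X) \<and>
     braid_relation_on X (ybe_map \<sigma> \<tau>)"

definition two_permutational :: "'a set \<Rightarrow> ('a \<Rightarrow> 'a \<Rightarrow> 'a) \<Rightarrow> ('a \<Rightarrow> 'a \<Rightarrow> 'a) \<Rightarrow> bool" where
  "two_permutational X \<sigma> \<tau> \<longleftrightarrow> (\<forall>x \<in> X. \<forall>y \<in> X. \<forall>z \<in> X. \<forall>w \<in> X.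
     \<sigma> (\<sigma> x z) w = \<sigma> (\<sigma> y z) w \<and>
     \<tau> (\<tau> x z) w = \<tau> (\<tau> y z) w \<and>
     \<sigma> (\<tau> x z) w = \<sigma> (\<tau> y z) w \<and>
     \<tau> (\<sigma> x z) w = \<tau> (\<sigma> y z) w)"

definition two_reductive :: "'a set \<Rightarrow> ('a \<Rightarrow> 'a \<Rightarrow> 'a) \<Rightarrow> ('a \<Rightarrow> 'a \<Rightarrow> 'a) \<Rightarrow> bool" where
  "two_reductive X \<sigma> \<tau> \<longleftrightarrow> (\<forall>x \<in> X. \<forall>y \<in> X. \<forall>w \<in> X.
     \<sigma> (\<sigma> x y) w = \<sigma> y w \<and>
     \<tau> (\<tau> x y) w = \<tau> y w \<and>
     \<sigma> (\<tau> x y) w = \<sigma> y w \<and>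
     \<tau> (\<sigma> x y) w = \<tau> y w)"

definition distributive_solution :: "'a set \<Rightarrow> ('a \<Rightarrow> 'a \<Rightarrow> 'a) \<Rightarrow> ('a \<Rightarrow> 'a \<Rightarrow> 'a) \<Rightarrow> bool" where
  "distributive_solution X \<sigma> \<tau> \<longleftrightarrow> (\<forall>x \<in> X. \<forall>y \<in> X. \<forall>w \<in> X.
     \<sigma> x (\<sigma> y w) = \<sigma> (\<sigma> x y) (\<sigma> x w) \<and>
     \<tau> x (\<tau> y w) = \<tau> (\<tau> x y) (\<tau> x w))"

text \<open>
  The symmetric group on \<open>X\<close> is \<^const>\<open>BijGroup\<close>, whose elements are extensional functions. Hence
  every map of \<open>X\<close> that is used as a group element is restricted to \<open>X\<close>.
\<close>

definition ybe_aut :: "'a set \<Rightarrow> ('a \<Rightarrow> 'a \<Rightarrow> 'a) \<Rightarrow> ('a \<Rightarrow> 'a \<Rightarrow> 'a) \<Rightarrow> ('a \<Rightarrow> 'a) set" where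
  "ybe_aut X \<sigma> \<tau> = {\<Phi> \<in> Bij X. \<forall>x \<in> X. \<forall>y \<in> X.
     \<Phi> (\<sigma> x y) = \<sigma> (\<Phi> x) (\<Phi> y) \<and> \<Phi> (\<tau> x y) = \<tau> (\<Phi> x) (\<Phi> y)}"

text \<open>\<open>diagonal_map X \<sigma>\<close> is $U$ and \<open>diagonal_map X \<tau>\<close> is $T$.\<close>

definition diagonal_map :: "'a set \<Rightarrow> ('a \<Rightarrow> 'a \<Rightarrow> 'a) \<Rightarrow> 'a \<Rightarrow> 'a" where
  "diagonal_map X \<rho> = (\<lambda>x \<in> X. inv_into X (\<rho> x) x)"

text \<open>
  \<^const>\<open>subgroup_generated\<close> silently drops generators outside the carrier, so their membership is
  demanded explicitly.
\<close>

definition generates_abelian_group :: "('a, 'b) monoid_scheme \<Rightarrow> 'a set \<Rightarrow> bool" where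
  "generates_abelian_group G S \<longleftrightarrow> S \<subseteq> carrier G \<and> comm_group (subgroup_generated G S)"

end

theory Submission
  imports Defs
begin

text \<open>
  Write \<open>A\<^sub>y\<close> for the map \<open>\<sigma> (\<sigma> u y)\<close>, which by 2-permutationality depends on \<open>y\<close> alone. Evaluating
  the first braid equation \<open>\<sigma>\<^sub>x \<sigma>\<^sub>y = \<sigma> (\<sigma>\<^sub>x y) \<sigma> (\<tau>\<^sub>y x)\<close> at \<open>T x\<close>, and using
  \<open>\<tau>\<^sub>x (T x) = x\<close>, gives \<open>\<sigma> (T x) \<sigma>\<^sub>y = A\<^sub>y \<sigma>\<^sub>x\<close> (lemma \<open>sigma_diagonal_twist\<close>). On the other hand,
  \<open>U\<close> commutes with all the maps \<open>\<sigma>\<^sub>x\<close> precisely when \<open>\<sigma>\<^sub>x y = A\<^sub>y \<sigma>\<^sub>x (U y)\<close>; rewriting the right-hand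
  side with the twisted identity and \<open>\<sigma>\<^sub>y (U y) = y\<close> turns this into \<open>\<sigma>\<^sub>x = \<sigma> (T x)\<close>. The twisted
  identity then becomes \<open>\<sigma>\<^sub>x \<sigma>\<^sub>y = A\<^sub>y \<sigma>\<^sub>x\<close>, whose case \<open>x = y\<close> is \<open>A\<^sub>y = \<sigma>\<^sub>y\<close>, and the braid equation
  yields \<open>\<sigma> (\<tau>\<^sub>u y) = \<sigma>\<^sub>y\<close> as well. Exchanging \<open>\<sigma>\<close> and \<open>\<tau>\<close> again gives a 2-permutational solution, so
  the commutation of \<open>T\<close> with the \<open>\<tau>\<^sub>x\<close> supplies the other half of 2-reductivity. Hence the weakest
  of the conditions, commutation of \<open>U\<close> with the \<open>\<sigma>\<^sub>x\<close> and of \<open>T\<close> with the \<open>\<tau>\<^sub>x\<close>, implies 2-reductivity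
  (lemma \<open>two_reductive_if_diagonals_commute\<close>).

  All other conditions lie between these two. In a 2-reductive solution the three braid equations say
  exactly that all the maps \<open>\<sigma>\<^sub>x\<close> and \<open>\<tau>\<^sub>x\<close> commute with one another, and then \<open>U\<close> and \<open>T\<close> commute
  with them and with each other; so the solution is distributive, these maps are automorphisms, and
  both groups are abelian. Conversely, the automorphism condition contains distributivity, which says
  that each \<open>\<sigma>\<^sub>x\<close> is an automorphism of the operation \<open>\<sigma>\<close>; such a map commutes with \<open>U\<close>, which is
  defined from \<open>\<sigma>\<close>, and likewise for \<open>\<tau>\<close> and \<open>T\<close>. Each of the two abelian groups contains the
  required commutations among the relations between its generators; for the group of pairs, the
  relation with \<open>U\<inverse>\<close> is turned into one with \<open>U\<close>, which relies on \<open>U\<close> being a bijection (lemma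
  \<open>diagonal_sigma_Bij\<close>).
\<close>

section \<open>Abelian groups generated by commuting elements\<close>

lemma (in group) commutes_inv:
  assumes "x \<in> carrier G" "y \<in> carrier G" "x \<otimes> y = y \<otimes> x"
  shows "x \<otimes> inv y = inv y \<otimes> x"
  using assms by (metis inv_closed inv_solve_left inv_solve_right m_assoc m_closed)

lemma (in group) commutes_inv_iff:
  assumes "x \<in> carrier G" "y \<in> carrier G"
  shows "x \<otimes> inv y = inv y \<otimes> x \<longleftrightarrow> x \<otimes> y = y \<otimes> x"
  using assms commutes_inv[of x y] commutes_inv[of x "inv y"] by auto

lemma (in group) commutes_generate:
  assumes "S \<subseteq> carrier G" "x \<in> carrier G" "\<And>s. s \<in> S \<Longrightarrow> x \<otimes> s = s \<otimes> x"
    and "g \<in> generate G S"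
  shows "x \<otimes> g = g \<otimes> x"
  using assms(4)
proof (induction rule: generate.induct)
  case (eng g h)
  then have "g \<in> carrier G" "h \<in> carrier G"
    using assms(1) generate_in_carrier by auto
  with eng assms(2) show ?case
    by (metis m_assoc)
qed (use assms commutes_inv in auto)

lemma (in group) generates_abelian_group_iff:
  "generates_abelian_group G S \<longleftrightarrow>
     S \<subseteq> carrier G \<and> (\<forall>x \<in> S. \<forall>y \<in> S. x \<otimes> y = y \<otimes> x)"
proof (cases "S \<subseteq> carrier G")
  case True
  then have carr: "carrier (subgroup_generated G S) = generate G S"
    by (simp add: carrier_subgroup_generated Int_absorb1)
  have "comm_group (subgroup_generated G S)"
    if comm: "\<And>x y. x \<in> S \<Longrightarrow> y \<in> S \<Longrightarrow> x \<otimes> y = y \<otimes> x"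
  proof (rule group.group_comm_groupI[OF group_subgroup_generated])
    fix g h
    assume gh: "g \<in> carrier (subgroup_generated G S)" "h \<in> carrier (subgroup_generated G S)"
    then have g: "g \<in> carrier G"
      using True carr generate_in_carrier by auto
    \<comment> \<open>Each generator commutes with \<open>g\<close>, so \<open>g\<close> commutes with everything generated.\<close>
    have "g \<otimes> s = s \<otimes> g" if "s \<in> S" for s
      using commutes_generate[of S s g] that comm True gh(1) carr by auto
    then show "g \<otimes>\<^bsub>subgroup_generated G S\<^esub> h = h \<otimes>\<^bsub>subgroup_generated G S\<^esub> g"
      using commutes_generate[of S g h] True g gh(2) carr by auto
  qed
  moreover have "x \<otimes> y = y \<otimes> x"
    if "comm_group (subgroup_generated G S)" "x \<in> S" "y \<in> S" for x y
    using comm_groupE(4)[OF that(1), of x y] that(2,3) carr by (auto intro: generate.incl)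
  ultimately show ?thesis
    using True by (auto simp: generates_abelian_group_def)
qed (simp add: generates_abelian_group_def)

lemma carrier_BijGroup [simp]: "carrier (BijGroup X) = Bij X"
  by (simp add: BijGroup_def)

lemma BijGroup_commute_iff:
  assumes "f \<in> Bij X" "g \<in> Bij X"
  shows "f \<otimes>\<^bsub>BijGroup X\<^esub> g = g \<otimes>\<^bsub>BijGroup X\<^esub> f \<longleftrightarrow> (\<forall>x \<in> X. f (g x) = g (f x))"
  using assms by (auto simp: BijGroup_def compose_def fun_eq_iff)

section \<open>Consequences of 2-permutationality\<close>

locale two_permutational_solution =
  fixes X :: "'a set" and \<sigma> \<tau> :: "'a \<Rightarrow> 'a \<Rightarrow> 'a"
  assumes solution: "ybe_solution X \<sigma> \<tau>"
    and permutational: "two_permutational X \<sigma> \<tau>"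
begin

abbreviation U :: "'a \<Rightarrow> 'a" where "U \<equiv> diagonal_map X \<sigma>"
abbreviation T :: "'a \<Rightarrow> 'a" where "T \<equiv> diagonal_map X \<tau>"

lemma sigma_bij: "x \<in> X \<Longrightarrow> bij_betw (\<sigma> x) X X"
  using solution by (simp add: ybe_solution_def)

lemma tau_bij: "x \<in> X \<Longrightarrow> bij_betw (\<tau> x) X X"
  using solution by (simp add: ybe_solution_def)

lemma sigma_closed [simp]: "x \<in> X \<Longrightarrow> y \<in> X \<Longrightarrow> \<sigma> x y \<in> X"
  using sigma_bij bij_betwE by blast

lemma tau_closed [simp]: "x \<in> X \<Longrightarrow> y \<in> X \<Longrightarrow> \<tau> x y \<in> X"
  using tau_bij bij_betwE by blast

lemma sigma_cancel: "x \<in> X \<Longrightarrow> y \<in> X \<Longrightarrow> z \<in> X \<Longrightarrow> \<sigma> x y = \<sigma> x z \<longleftrightarrow> y = z"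
  using sigma_bij by (metis bij_betw_def inj_on_def)

lemma sigma_surj: "x \<in> X \<Longrightarrow> w \<in> X \<Longrightarrow> \<exists>v \<in> X. w = \<sigma> x v"
  using sigma_bij by (metis bij_betw_def imageE)

lemma sigma_diagonal: "x \<in> X \<Longrightarrow> \<sigma> x (U x) = x"
  using bij_betw_inv_into_right[OF sigma_bij] by (simp add: diagonal_map_def)

lemma diagonal_sigma_closed [simp]: "x \<in> X \<Longrightarrow> U x \<in> X"
  using sigma_bij by (simp add: diagonal_map_def bij_betw_def inv_into_into)

lemma
  assumes "x \<in> X" "y \<in> X" "z \<in> X"
  shows braid_sigma: "\<sigma> x (\<sigma> y z) = \<sigma> (\<sigma> x y) (\<sigma> (\<tau> y x) z)"
    and braid_mixed: "\<tau> (\<sigma> (\<tau> y x) z) (\<sigma> x y) = \<sigma> (\<tau> (\<sigma> y z) x) (\<tau> z y)"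
    and braid_tau: "\<tau> z (\<tau> y x) = \<tau> (\<tau> z y) (\<tau> (\<sigma> y z) x)"
proof -
  have "braid_relation_on X (ybe_map \<sigma> \<tau>)"
    using solution by (simp add: ybe_solution_def)
  then have "map_last_two (ybe_map \<sigma> \<tau>) (map_first_two (ybe_map \<sigma> \<tau>)
        (map_last_two (ybe_map \<sigma> \<tau>) (x, y, z))) =
      map_first_two (ybe_map \<sigma> \<tau>) (map_last_two (ybe_map \<sigma> \<tau>)
        (map_first_two (ybe_map \<sigma> \<tau>) (x, y, z)))"
    using assms unfolding braid_relation_on_def by blast
  then show "\<sigma> x (\<sigma> y z) = \<sigma> (\<sigma> x y) (\<sigma> (\<tau> y x) z)"
    and "\<tau> (\<sigma> (\<tau> y x) z) (\<sigma> x y) = \<sigma> (\<tau> (\<sigma> y z) x) (\<tau> z y)"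
    and "\<tau> z (\<tau> y x) = \<tau> (\<tau> z y) (\<tau> (\<sigma> y z) x)"
    by (simp_all add: map_first_two_def map_last_two_def ybe_map_def)
qed

text \<open>
  Reversing the order of the factors of \<open>X \<times> X\<close> exchanges \<open>\<sigma>\<close> and \<open>\<tau>\<close> and the two sides of the braid
  relation, so every fact about \<open>\<sigma>\<close> and \<open>U\<close> has a mirror image about \<open>\<tau>\<close> and \<open>T\<close>.
\<close>

lemma mirror: "two_permutational_solution X \<tau> \<sigma>"
proof
  show "ybe_solution X \<tau> \<sigma>"
    unfolding ybe_solution_def braid_relation_on_def
    using sigma_bij tau_bij
    by (auto simp: map_first_two_def map_last_two_def ybe_map_def
        braid_sigma[symmetric] braid_mixed braid_tau[symmetric])
  show "two_permutational X \<tau> \<sigma>"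
    using permutational unfolding two_permutational_def by blast
qed

lemma
  assumes "x \<in> X" "y \<in> X" "z \<in> X" "w \<in> X"
  shows sigma_sigma_indep: "\<sigma> (\<sigma> x z) w = \<sigma> (\<sigma> y z) w"
    and sigma_tau_indep: "\<sigma> (\<tau> x z) w = \<sigma> (\<tau> y z) w"
  using permutational assms unfolding two_permutational_def by blast+

lemma diagonal_sigma_Bij: "U \<in> Bij X"
proof -
  have "inj_on U X"
  proof (rule inj_onI)
    fix x y assume xy: "x \<in> X" "y \<in> X" "U x = U y"
    \<comment> \<open>The map \<open>\<sigma>\<^sub>x\<close> is recovered from \<open>U x\<close>, as \<open>\<sigma> (\<sigma>\<^sub>u (U x))\<close> for any \<open>u\<close>.\<close>
    have "x = \<sigma> (\<sigma> x (U x)) (U x)"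
      using sigma_diagonal[OF xy(1)] by simp
    also have "\<dots> = \<sigma> (\<sigma> y (U x)) (U x)"
      using xy by (intro sigma_sigma_indep) simp_all
    also have "\<dots> = y"
      using sigma_diagonal[OF xy(2)] unfolding xy(3) by simp
    finally show "x = y" .
  qed
  moreover have "\<exists>y \<in> X. w = U y" if w: "w \<in> X" for w
  proof
    \<comment> \<open>A preimage \<open>y\<close> has to satisfy \<open>\<sigma>\<^sub>y w = y\<close>, and \<open>\<sigma>\<^sub>y\<close> is then the map \<open>\<sigma> (\<sigma>\<^sub>u w)\<close>.\<close>
    let ?y = "\<sigma> (\<sigma> w w) w"
    show y: "?y \<in> X"
      using w by simp
    have "\<sigma> ?y w = ?y"
      using sigma_sigma_indep[of "\<sigma> w w" w w w] w by simp
    then show "w = U ?y"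
      using sigma_cancel[of ?y w "U ?y"] sigma_diagonal[OF y] y w by simp
  qed
  ultimately have "bij_betw U X X"
    by (auto simp: bij_betw_def)
  then show ?thesis
    by (simp add: Bij_def diagonal_map_def)
qed

text \<open>
  The braid equation at \<open>(T x, y)\<close>: the inner map \<open>\<sigma> (\<tau>\<^sub>y (T x))\<close> may be computed with \<open>\<tau>\<^sub>x\<close> in place
  of \<open>\<tau>\<^sub>y\<close>, and so is \<open>\<sigma>\<^sub>x\<close>.
\<close>

lemma sigma_diagonal_twist:
  assumes "x \<in> X" "y \<in> X" "z \<in> X" "u \<in> X"
  shows "\<sigma> (T x) (\<sigma> y z) = \<sigma> (\<sigma> u y) (\<sigma> x z)"
proof -
  interpret mirror: two_permutational_solution X \<tau> \<sigma> by (rule mirror)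
  have T: "T x \<in> X" "\<tau> x (T x) = x"
    using assms mirror.sigma_diagonal by auto
  have "\<sigma> (\<tau> y (T x)) z = \<sigma> x z"
    using sigma_tau_indep[of y x "T x" z] assms T by simp
  then have "\<sigma> (T x) (\<sigma> y z) = \<sigma> (\<sigma> (T x) y) (\<sigma> x z)"
    using braid_sigma[of "T x" y z] assms T by simp
  then show ?thesis
    using sigma_sigma_indep[of "T x" u y "\<sigma> x z"] assms T by simp
qed

section \<open>Commutation with the diagonal maps forces 2-reductivity\<close>

lemma sigma_reductive_if_diagonal_commutes:
  assumes comm: "\<And>x y. x \<in> X \<Longrightarrow> y \<in> X \<Longrightarrow> U (\<sigma> x y) = \<sigma> x (U y)"
    and "x \<in> X" "y \<in> X" "w \<in> X"
  shows "\<sigma> (\<sigma> x y) w = \<sigma> y w" and "\<sigma> (\<tau> x y) w = \<sigma> y w"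
proof -
  have sigma_T: "\<sigma> (T a) b = \<sigma> a b" if "a \<in> X" "b \<in> X" for a b
  proof -
    have "\<sigma> a b = \<sigma> (\<sigma> a b) (\<sigma> a (U b))"
      using that comm sigma_diagonal by (metis sigma_closed)
    also have "\<dots> = \<sigma> (T a) (\<sigma> b (U b))"
      using that by (simp add: sigma_diagonal_twist)
    finally show ?thesis
      using that sigma_diagonal by simp
  qed
  have sigma_sq: "\<sigma> (\<sigma> y y) b = \<sigma> y b" if b: "b \<in> X" for b
  proof -
    obtain v where v: "v \<in> X" "b = \<sigma> y v"
      using sigma_surj assms(3) b by blast
    have "\<sigma> (\<sigma> y y) (\<sigma> y v) = \<sigma> y (\<sigma> y v)"
      using sigma_diagonal_twist[of y y v y] sigma_T assms v by simp
    with v show ?thesis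
      by simp
  qed
  then show "\<sigma> (\<sigma> x y) w = \<sigma> y w"
    using sigma_sigma_indep[of x y y w] assms by simp
  have "\<sigma> y (\<sigma> y w) = \<sigma> y (\<sigma> (\<tau> y y) w)"
    using braid_sigma[of y y w] sigma_sq assms by simp
  then have "\<sigma> y w = \<sigma> (\<tau> y y) w"
    using sigma_cancel assms by simp
  then show "\<sigma> (\<tau> x y) w = \<sigma> y w"
    using sigma_tau_indep[of x y y w] assms by simp
qed

lemma two_reductive_if_diagonals_commute:
  assumes "\<And>x y. x \<in> X \<Longrightarrow> y \<in> X \<Longrightarrow> U (\<sigma> x y) = \<sigma> x (U y)"
    and "\<And>x y. x \<in> X \<Longrightarrow> y \<in> X \<Longrightarrow> T (\<tau> x y) = \<tau> x (T y)"
  shows "two_reductive X \<sigma> \<tau>"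
proof -
  interpret mirror: two_permutational_solution X \<tau> \<sigma> by (rule mirror)
  show ?thesis
    unfolding two_reductive_def
    using sigma_reductive_if_diagonal_commutes[OF assms(1)]
      mirror.sigma_reductive_if_diagonal_commutes[OF assms(2)]
    by blast
qed

text \<open>
  Any automorphism of the operation \<open>\<sigma>\<close> commutes with \<open>U\<close>, because \<open>U x\<close> is the unique solution
  \<open>u\<close> of \<open>\<sigma> x u = x\<close>.
\<close>

lemma diagonal_commutes_if_hom:
  assumes \<Phi>: "\<And>x. x \<in> X \<Longrightarrow> \<Phi> x \<in> X"
    and hom: "\<And>x y. x \<in> X \<Longrightarrow> y \<in> X \<Longrightarrow> \<Phi> (\<sigma> x y) = \<sigma> (\<Phi> x) (\<Phi> y)"
    and x: "x \<in> X"
  shows "U (\<Phi> x) = \<Phi> (U x)"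
proof -
  have "\<sigma> (\<Phi> x) (\<Phi> (U x)) = \<sigma> (\<Phi> x) (U (\<Phi> x))"
    using hom[of x "U x"] x \<Phi> sigma_diagonal by simp
  then show ?thesis
    using sigma_cancel x \<Phi> by simp
qed

lemma diagonals_commute_if_distributive:
  assumes "distributive_solution X \<sigma> \<tau>" "x \<in> X" "y \<in> X"
  shows "U (\<sigma> x y) = \<sigma> x (U y)" and "T (\<tau> x y) = \<tau> x (T y)"
proof -
  interpret mirror: two_permutational_solution X \<tau> \<sigma> by (rule mirror)
  have hom: "\<sigma> a (\<sigma> b c) = \<sigma> (\<sigma> a b) (\<sigma> a c)" "\<tau> a (\<tau> b c) = \<tau> (\<tau> a b) (\<tau> a c)"
    if "a \<in> X" "b \<in> X" "c \<in> X" for a b c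
    using assms(1) that unfolding distributive_solution_def by blast+
  show "U (\<sigma> x y) = \<sigma> x (U y)"
    by (rule diagonal_commutes_if_hom[OF sigma_closed[OF assms(2)] hom(1)[OF assms(2)] assms(3)])
  show "T (\<tau> x y) = \<tau> x (T y)"
    by (rule mirror.diagonal_commutes_if_hom
        [OF tau_closed[OF assms(2)] hom(2)[OF assms(2)] assms(3)])
qed

section \<open>Commutation in a 2-reductive solution\<close>

context
  assumes reductive: "two_reductive X \<sigma> \<tau>"
begin

lemma reductive_simps:
  assumes "x \<in> X" "y \<in> X" "w \<in> X"
  shows "\<sigma> (\<sigma> x y) w = \<sigma> y w" "\<tau> (\<tau> x y) w = \<tau> y w"
    "\<sigma> (\<tau> x y) w = \<sigma> y w" "\<tau> (\<sigma> x y) w = \<tau> y w"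
  using reductive assms unfolding two_reductive_def by blast+

lemma operations_commute:
  assumes "x \<in> X" "y \<in> X" "w \<in> X"
  shows "\<sigma> x (\<sigma> y w) = \<sigma> y (\<sigma> x w)" "\<tau> x (\<tau> y w) = \<tau> y (\<tau> x w)"
    "\<sigma> x (\<tau> y w) = \<tau> y (\<sigma> x w)"
  using braid_sigma[of x y w] braid_tau[of w y x] braid_mixed[of x w y] assms
  by (simp_all add: reductive_simps)

lemma operations_hom:
  assumes "x \<in> X" "y \<in> X" "w \<in> X"
  shows "\<sigma> x (\<sigma> y w) = \<sigma> (\<sigma> x y) (\<sigma> x w)" "\<tau> x (\<tau> y w) = \<tau> (\<tau> x y) (\<tau> x w)"
    "\<sigma> x (\<tau> y w) = \<tau> (\<sigma> x y) (\<sigma> x w)" "\<tau> x (\<sigma> y w) = \<sigma> (\<tau> x y) (\<tau> x w)"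
  using operations_commute(1)[of x y w] operations_commute(2)[of x y w]
    operations_commute(3)[of x y w] operations_commute(3)[of y x w] assms
  by (simp_all add: reductive_simps)

lemma diagonals_commute:
  assumes "x \<in> X" "y \<in> X"
  shows "U (\<sigma> x y) = \<sigma> x (U y)" "U (\<tau> x y) = \<tau> x (U y)"
    "T (\<sigma> x y) = \<sigma> x (T y)" "T (\<tau> x y) = \<tau> x (T y)"
proof -
  interpret mirror: two_permutational_solution X \<tau> \<sigma> by (rule mirror)
  note sigma = sigma_closed[OF assms(1)] and tau = tau_closed[OF assms(1)]
  show "U (\<sigma> x y) = \<sigma> x (U y)"
    by (rule diagonal_commutes_if_hom[OF sigma operations_hom(1)[OF assms(1)] assms(2)])
  show "U (\<tau> x y) = \<tau> x (U y)"
    by (rule diagonal_commutes_if_hom[OF tau operations_hom(4)[OF assms(1)] assms(2)])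
  show "T (\<sigma> x y) = \<sigma> x (T y)"
    by (rule mirror.diagonal_commutes_if_hom[OF sigma operations_hom(3)[OF assms(1)] assms(2)])
  show "T (\<tau> x y) = \<tau> x (T y)"
    by (rule mirror.diagonal_commutes_if_hom[OF tau operations_hom(2)[OF assms(1)] assms(2)])
qed

lemma diagonals_commute_mutually:
  assumes x: "x \<in> X"
  shows "U (T x) = T (U x)"
proof -
  interpret mirror: two_permutational_solution X \<tau> \<sigma> by (rule mirror)
  have "\<tau> x (U (T x)) = U x"
    using diagonals_commute(2)[of x "T x"] mirror.sigma_diagonal x by simp
  also have "\<dots> = \<tau> (U x) (T (U x))"
    using mirror.sigma_diagonal[of "U x"] x by simp
  \<comment> \<open>By reductivity, \<open>U x\<close> and \<open>\<sigma>\<^sub>x (U x) = x\<close> have the same map \<open>\<tau>\<close>.\<close>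
  also have "\<dots> = \<tau> x (T (U x))"
    using reductive_simps(4)[of x "U x" "T (U x)"] sigma_diagonal x by simp
  finally show ?thesis
    using mirror.sigma_cancel[of x "U (T x)" "T (U x)"] x by simp
qed

end

section \<open>The equivalences\<close>

lemma operations_Bij:
  assumes "x \<in> X"
  shows "restrict (\<sigma> x) X \<in> Bij X" "restrict (\<tau> x) X \<in> Bij X"
  using sigma_bij tau_bij assms by (auto simp: Bij_def)

lemma two_reductive_iff_diagonals_commute:
  "two_reductive X \<sigma> \<tau> \<longleftrightarrow>
     (\<forall>x \<in> X. \<forall>y \<in> X. U (\<sigma> x y) = \<sigma> x (U y) \<and> T (\<tau> x y) = \<tau> x (T y))"
  using two_reductive_if_diagonals_commute diagonals_commute by blast

lemma two_reductive_iff_distributive: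
  "two_reductive X \<sigma> \<tau> \<longleftrightarrow> distributive_solution X \<sigma> \<tau>"
proof
  assume "two_reductive X \<sigma> \<tau>"
  then show "distributive_solution X \<sigma> \<tau>"
    unfolding distributive_solution_def using operations_hom(1,2) by blast
next
  assume "distributive_solution X \<sigma> \<tau>"
  then show "two_reductive X \<sigma> \<tau>"
    using two_reductive_if_diagonals_commute diagonals_commute_if_distributive by blast
qed

lemma two_reductive_iff_automorphisms:
  "two_reductive X \<sigma> \<tau> \<longleftrightarrow>
     (\<lambda>x. restrict (\<sigma> x) X) ` X \<union> (\<lambda>x. restrict (\<tau> x) X) ` X \<subseteq> ybe_aut X \<sigma> \<tau>"
    (is "_ \<longleftrightarrow> ?aut")
proof
  assume "two_reductive X \<sigma> \<tau>"
  note hom = operations_hom[OF this]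
  have "restrict (\<sigma> x) X \<in> ybe_aut X \<sigma> \<tau>" "restrict (\<tau> x) X \<in> ybe_aut X \<sigma> \<tau>"
    if x: "x \<in> X" for x
    using operations_Bij[OF x] x hom(1,3)[OF x] hom(4,2)[OF x]
    by (simp_all add: ybe_aut_def)
  then show ?aut
    by blast
next
  assume ?aut
  then have aut: "restrict (\<sigma> x) X \<in> ybe_aut X \<sigma> \<tau>" "restrict (\<tau> x) X \<in> ybe_aut X \<sigma> \<tau>"
    if "x \<in> X" for x
    using that by blast+
  have "\<sigma> x (\<sigma> y w) = \<sigma> (\<sigma> x y) (\<sigma> x w) \<and> \<tau> x (\<tau> y w) = \<tau> (\<tau> x y) (\<tau> x w)"
    if "x \<in> X" "y \<in> X" "w \<in> X" for x y w
  proof -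
    have "restrict (\<sigma> x) X (\<sigma> y w) = \<sigma> (restrict (\<sigma> x) X y) (restrict (\<sigma> x) X w)"
      "restrict (\<tau> x) X (\<tau> y w) = \<tau> (restrict (\<tau> x) X y) (restrict (\<tau> x) X w)"
      using aut[OF that(1)] that(2,3) unfolding ybe_aut_def by blast+
    with that show ?thesis
      by simp
  qed
  then have "distributive_solution X \<sigma> \<tau>"
    unfolding distributive_solution_def by blast
  then show "two_reductive X \<sigma> \<tau>"
    by (simp add: two_reductive_iff_distributive)
qed

lemma two_reductive_iff_permutations_abelian:
  "two_reductive X \<sigma> \<tau> \<longleftrightarrow> generates_abelian_group (BijGroup X)
     ((\<lambda>x. restrict (\<sigma> x) X) ` X \<union> (\<lambda>x. restrict (\<tau> x) X) ` X \<union> {U, T})"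
    (is "_ \<longleftrightarrow> generates_abelian_group _ ?S")
proof -
  interpret mirror: two_permutational_solution X \<tau> \<sigma> by (rule mirror)
  have S: "?S \<subseteq> Bij X"
    using operations_Bij diagonal_sigma_Bij mirror.diagonal_sigma_Bij by auto
  have "generates_abelian_group (BijGroup X) ?S \<longleftrightarrow>
      (\<forall>f \<in> ?S. \<forall>g \<in> ?S. f \<otimes>\<^bsub>BijGroup X\<^esub> g = g \<otimes>\<^bsub>BijGroup X\<^esub> f)"
    using S by (simp only: group.generates_abelian_group_iff[OF group_BijGroup] carrier_BijGroup)
      blast
  also have "\<dots> \<longleftrightarrow> (\<forall>f \<in> ?S. \<forall>g \<in> ?S. \<forall>y \<in> X. f (g y) = g (f y))"
    by (intro ball_cong refl BijGroup_commute_iff) (use S in blast)+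
  also have "\<dots> \<longleftrightarrow> two_reductive X \<sigma> \<tau>"
  proof
    assume comm: "\<forall>f \<in> ?S. \<forall>g \<in> ?S. \<forall>y \<in> X. f (g y) = g (f y)"
    have "U (\<sigma> x y) = \<sigma> x (U y) \<and> T (\<tau> x y) = \<tau> x (T y)" if "x \<in> X" "y \<in> X" for x y
      using comm[rule_format, of U "restrict (\<sigma> x) X" y]
        comm[rule_format, of T "restrict (\<tau> x) X" y] that by simp
    then show "two_reductive X \<sigma> \<tau>"
      by (simp add: two_reductive_iff_diagonals_commute)
  next
    assume "two_reductive X \<sigma> \<tau>"
    note comm = operations_commute[OF this] diagonals_commute[OF this]
      diagonals_commute_mutually[OF this]
    show "\<forall>f \<in> ?S. \<forall>g \<in> ?S. \<forall>y \<in> X. f (g y) = g (f y)"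
      by (intro ballI) (elim UnE imageE insertE emptyE; simp add: comm)
  qed
  finally show ?thesis
    by blast
qed

text \<open>
  Multiplication in the product group is componentwise, and replacing an element by its inverse does
  not affect which elements it commutes with. So the generating pairs commute exactly when \<open>U\<close> and the
  \<open>\<sigma>\<^sub>x\<close> commute among themselves and so do \<open>T\<close> and the \<open>\<tau>\<^sub>x\<close>.
\<close>

lemma two_reductive_iff_pairs_abelian:
  "two_reductive X \<sigma> \<tau> \<longleftrightarrow> generates_abelian_group (BijGroup X \<times>\<times> BijGroup X)
     ((\<lambda>x. (restrict (\<sigma> x) X, inv\<^bsub>BijGroup X\<^esub> (restrict (\<tau> x) X))) ` X
        \<union> {(inv\<^bsub>BijGroup X\<^esub> U, T)})"
    (is "_ \<longleftrightarrow> generates_abelian_group _ ?S")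
proof -
  interpret mirror: two_permutational_solution X \<tau> \<sigma> by (rule mirror)
  interpret Sym: group "BijGroup X" by (rule group_BijGroup)
  interpret SymSym: group "BijGroup X \<times>\<times> BijGroup X"
    by (rule DirProd_group[OF group_BijGroup group_BijGroup])
  let ?s = "\<lambda>x. restrict (\<sigma> x) X" and ?t = "\<lambda>x. restrict (\<tau> x) X"
  let ?comm = "\<lambda>f g. f \<otimes>\<^bsub>BijGroup X\<^esub> g = g \<otimes>\<^bsub>BijGroup X\<^esub> f"
  note carr = operations_Bij and diag = diagonal_sigma_Bij mirror.diagonal_sigma_Bij
  have inv_iff: "?comm f (inv\<^bsub>BijGroup X\<^esub> g) \<longleftrightarrow> ?comm f g"
      "?comm (inv\<^bsub>BijGroup X\<^esub> g) f \<longleftrightarrow> ?comm g f"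
    if "f \<in> Bij X" "g \<in> Bij X" for f g
    using Sym.commutes_inv_iff[of f g] that by auto
  have inv_Bij: "inv\<^bsub>BijGroup X\<^esub> f \<in> Bij X" if "f \<in> Bij X" for f
    using Sym.inv_closed that by simp
  have S: "?S \<subseteq> carrier (BijGroup X \<times>\<times> BijGroup X)"
    using carr diag inv_Bij by auto
  have "generates_abelian_group (BijGroup X \<times>\<times> BijGroup X) ?S \<longleftrightarrow>
      (\<forall>(f, g) \<in> ?S. \<forall>(f', g') \<in> ?S. ?comm f f' \<and> ?comm g g')"
    using S by (auto simp: SymSym.generates_abelian_group_iff)
  also have "\<dots> \<longleftrightarrow> (\<forall>x \<in> X. ?comm (?s x) U \<and> ?comm (?t x) T \<and>
      (\<forall>y \<in> X. ?comm (?s x) (?s y) \<and> ?comm (?t x) (?t y)))"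
    using carr diag by (auto simp: inv_iff inv_Bij)
  also have "\<dots> \<longleftrightarrow> (\<forall>x \<in> X. \<forall>y \<in> X. U (\<sigma> x y) = \<sigma> x (U y) \<and> T (\<tau> x y) = \<tau> x (T y) \<and>
      (\<forall>w \<in> X. \<sigma> x (\<sigma> y w) = \<sigma> y (\<sigma> x w) \<and> \<tau> x (\<tau> y w) = \<tau> y (\<tau> x w)))"
  proof -
    have "?comm (?s x) U \<longleftrightarrow> (\<forall>y \<in> X. \<sigma> x (U y) = U (\<sigma> x y))"
        "?comm (?t x) T \<longleftrightarrow> (\<forall>y \<in> X. \<tau> x (T y) = T (\<tau> x y))"
      if "x \<in> X" for x
      using carr[OF that] diag that by (simp_all add: BijGroup_commute_iff)
    moreover have "?comm (?s x) (?s y) \<longleftrightarrow> (\<forall>w \<in> X. \<sigma> x (\<sigma> y w) = \<sigma> y (\<sigma> x w))"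
        "?comm (?t x) (?t y) \<longleftrightarrow> (\<forall>w \<in> X. \<tau> x (\<tau> y w) = \<tau> y (\<tau> x w))"
      if "x \<in> X" "y \<in> X" for x y
      using carr[OF that(1)] carr[OF that(2)] that by (simp_all add: BijGroup_commute_iff)
    ultimately show ?thesis
      by (simp add: ball_conj_distrib eq_commute cong: ball_cong)
  qed
  also have "\<dots> \<longleftrightarrow> two_reductive X \<sigma> \<tau>"
    using two_reductive_iff_diagonals_commute operations_commute(1,2) by blast
  finally show ?thesis
    by blast
qed

end

theorem proposition7p2:
  fixes X :: "'a set" and \<sigma> \<tau> :: "'a \<Rightarrow> 'a \<Rightarrow> 'a"
  assumes "ybe_solution X \<sigma> \<tau>"
    and "two_permutational X \<sigma> \<tau>"
  defines "SX \<equiv> BijGroup X"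
    and "\<sigma>' \<equiv> \<lambda>x. restrict (\<sigma> x) X"
    and "\<tau>' \<equiv> \<lambda>x. restrict (\<tau> x) X"
    and "U \<equiv> diagonal_map X \<sigma>"
    and "T \<equiv> diagonal_map X \<tau>"
  shows "(two_reductive X \<sigma> \<tau> \<longleftrightarrow> distributive_solution X \<sigma> \<tau>)
    \<and> (two_reductive X \<sigma> \<tau> \<longleftrightarrow> \<sigma>' ` X \<union> \<tau>' ` X \<subseteq> ybe_aut X \<sigma> \<tau>)
    \<and> (two_reductive X \<sigma> \<tau> \<longleftrightarrow>
         generates_abelian_group SX (\<sigma>' ` X \<union> \<tau>' ` X \<union> {U, T}))
    \<and> (two_reductive X \<sigma> \<tau> \<longleftrightarrow>
         generates_abelian_group (SX \<times>\<times> SX)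
           ((\<lambda>x. (\<sigma>' x, inv\<^bsub>SX\<^esub> (\<tau>' x))) ` X \<union> {(inv\<^bsub>SX\<^esub> U, T)}))
    \<and> (two_reductive X \<sigma> \<tau> \<longleftrightarrow>
         (\<forall>x \<in> X. \<forall>y \<in> X. U (\<sigma> x y) = \<sigma> x (U y) \<and> T (\<tau> x y) = \<tau> x (T y)))"
proof -
  interpret two_permutational_solution X \<sigma> \<tau>
    using assms(1,2) by unfold_locales
  show ?thesis
    unfolding SX_def \<sigma>'_def \<tau>'_def U_def T_def
    using two_reductive_iff_distributive two_reductive_iff_automorphisms
      two_reductive_iff_permutations_abelian two_reductive_iff_pairs_abelian
      two_reductive_iff_diagonals_commute
    by blast
qed

end
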